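(* Let $d\ge3$, let $\gamma,\beta<d$ be real numbers such that $\gamma-2<\beta\le\gamma(d-2)/d$, and let $m\in(m_c,1)$ with $m_c=\frac{d-2-\beta}{d-\gamma}$. Assume that $f$ is measurable with $\int_{\mathbb{R}^d}|f(x)||x|^{-\gamma}\,dx<\infty$. Then $$\sup_{R>0}R^{\frac{2+\beta-\gamma}{1-m}-(d-\gamma)}\int_{\mathbb{R}^d\setminus B_R(0)}|f(x)||x|^{-\gamma}\,dx<\infty$$ if and only if $$\int_{B_{|x|/2}(x)}|f(y)||y|^{-\gamma}\,dy=\mathrm{O}\!\left(|x|^{\,d-\gamma-\frac{2+\beta-\gamma}{1-m}}\right)\qquad\text{as }|x|\to\infty .$$
   Context: $B_r(x)$ denotes the ball of radius $r$ centred at $x$ in $\mathbb{R}^d$. Since $m>m_c$, one has $\frac{2+\beta-\gamma}{1-m}-(d-\gamma)>0$. *)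

theory Defs
  imports "HOL-Analysis.Analysis" "HOL-Library.Landau_Symbols"
begin

definition m_c :: "nat \<Rightarrow> real \<Rightarrow> real \<Rightarrow> real" where
  "m_c d \<gamma> \<beta> = (real d - 2 - \<beta>) / (real d - \<gamma>)"

end

theory Submission
  imports Defs
begin

text \<open>
  Let \<open>\<nu>\<close> be the finite measure with density \<open>\<bar>f x\<bar> * norm x powr (- \<gamma>)\<close>, and let
  \<open>a = (2 + \<beta> - \<gamma>) / (1 - m) - (d - \<gamma>)\<close>, which is positive because \<open>m > m\<^sub>c\<close>. The equivalence
  holds for every finite measure and every positive exponent: the tails
  \<open>\<nu> (UNIV - ball 0 R)\<close> are bounded by a multiple of \<open>R powr -a\<close> for all \<open>R > 0\<close> if and only
  if the masses of the balls \<open>ball x (norm x / 2)\<close> are \<open>O(norm x powr -a)\<close> at infinity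
  (\<open>tail_decay_iff_ball_decay\<close>).

  Such a ball lies outside the ball of radius \<open>norm x / 2\<close> about the origin, so decay of
  the tails gives decay on balls. Conversely, the shell \<open>1 \<le> norm y \<le> 2\<close> is compact, hence
  covered by finitely many of these balls; as the family of balls is invariant under dilations,
  the same number \<open>N\<close> of them covers every shell \<open>R \<le> norm y \<le> 2 * R\<close>
  (\<open>finite_dilated_ball_cover_shell\<close>). Each shell thus has mass at most \<open>N * C * R powr -a\<close>, and
  since \<open>a > 0\<close> the dyadic shells outside radius \<open>R\<close> sum up as a geometric series
  (\<open>tail_bound_if_shell_bound\<close>). The values of \<open>R\<close> below the range of the asymptotic bound are
  harmless because \<open>\<nu>\<close> is finite and \<open>R powr a\<close> is bounded for bounded \<open>R\<close>.
\<close>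

section \<open>Covering shells by balls\<close>

text \<open>The centres work for all scales \<open>R\<close> at once, because dilation by \<open>R\<close> maps
  \<open>ball x (norm x / 2)\<close> onto the corresponding ball at \<open>R *\<^sub>R x\<close>.\<close>

lemma finite_dilated_ball_cover_shell:
  obtains X :: "'a::euclidean_space set" where "finite X" and "\<And>x. x \<in> X \<Longrightarrow> norm x \<ge> 1"
    and "\<And>R. R > 0 \<Longrightarrow> cball 0 (2 * R) - ball 0 R \<subseteq> (\<Union>x\<in>X. ball (R *\<^sub>R x) (norm (R *\<^sub>R x) / 2))"
proof -
  let ?S = "cball (0::'a) 2 - ball 0 1"
  have "compact ?S"
    by (intro compact_diff) auto
  moreover have "?S \<subseteq> (\<Union>x\<in>?S. ball x (norm x / 2))"
  proof
    fix y :: 'a assume y: "y \<in> ?S"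
    then have "y \<in> ball y (norm y / 2)" by auto
    with y show "y \<in> (\<Union>x\<in>?S. ball x (norm x / 2))" by blast
  qed
  ultimately obtain X where X: "X \<subseteq> ?S" "finite X" "?S \<subseteq> (\<Union>x\<in>X. ball x (norm x / 2))"
    by (elim compactE_image) auto
  show thesis
  proof
    show "finite X" by fact
    show "norm x \<ge> 1" if "x \<in> X" for x
      using that X(1) by auto
    show "cball 0 (2 * R) - ball 0 R \<subseteq> (\<Union>x\<in>X. ball (R *\<^sub>R x) (norm (R *\<^sub>R x) / 2))" if R: "R > 0" for R
    proof
      fix y :: 'a assume y: "y \<in> cball 0 (2 * R) - ball 0 R"
      define z where "z = y /\<^sub>R R"
      have yz: "y = R *\<^sub>R z"
        using R by (simp add: z_def)
      have "z \<in> ?S"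
        using y R by (auto simp: z_def field_simps)
      then obtain x where x: "x \<in> X" "dist x z < norm x / 2"
        using X(3) by (auto simp: mem_ball)
      have "dist (R *\<^sub>R x) y = R * dist x z"
        using R by (simp add: yz dist_norm flip: scaleR_diff_right)
      also have "\<dots> < R * (norm x / 2)"
        using x R by (intro mult_strict_left_mono) auto
      also have "\<dots> = norm (R *\<^sub>R x) / 2"
        using R by simp
      finally show "y \<in> (\<Union>x\<in>X. ball (R *\<^sub>R x) (norm (R *\<^sub>R x) / 2))"
        using x(1) by (auto simp: mem_ball)
    qed
  qed
qed

lemma outside_ball_eq_Union_dyadic_shells:
  fixes R :: real
  assumes R: "R > 0"
  shows "UNIV - ball (0::'a::euclidean_space) R
    = (\<Union>k. cball 0 (2 * (2 ^ k * R)) - ball 0 (2 ^ k * R))"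
proof (intro equalityI subsetI)
  fix y :: 'a assume "y \<in> UNIV - ball 0 R"
  then have y: "norm y \<ge> R" by auto
  obtain n where "norm y / R < 2 ^ n"
    using real_arch_pow[of 2 "norm y / R"] by auto
  then have "norm y < 2 ^ n * R"
    using R by (simp add: pos_divide_less_eq)
  then have ex: "norm y \<le> 2 * (2 ^ n * R)"
    using norm_ge_zero[of y] by linarith
  define k where "k = (LEAST k. norm y \<le> 2 * (2 ^ k * R))"
  have k: "norm y \<le> 2 * (2 ^ k * R)"
    unfolding k_def using ex by (rule LeastI)
  moreover have "2 ^ k * R \<le> norm y"
  proof (cases k)
    case (Suc j)
    then have "\<not> norm y \<le> 2 * (2 ^ j * R)"
      unfolding k_def by (intro not_less_Least) simp
    then show ?thesis using Suc by simp
  qed (use y in simp)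
  ultimately show "y \<in> (\<Union>k. cball 0 (2 * (2 ^ k * R)) - ball 0 (2 ^ k * R))"
    by (intro UN_I[of k]) auto
next
  fix y :: 'a assume "y \<in> (\<Union>k. cball 0 (2 * (2 ^ k * R)) - ball 0 (2 ^ k * R))"
  then obtain k where k: "2 ^ k * R \<le> norm y" by (auto simp: not_less)
  have "1 * R \<le> 2 ^ k * R"
    using R by (intro mult_right_mono) auto
  with k show "y \<in> UNIV - ball 0 R" by auto
qed

section \<open>Tail decay and ball decay of a finite measure\<close>

text \<open>The shells at radii \<open>2 ^ k * R\<close> have masses bounded by a geometric progression of
  ratio \<open>2 powr -a\<close>.\<close>

lemma tail_bound_if_shell_bound:
  fixes \<nu> :: "'a::euclidean_space measure"
  assumes fin: "finite_measure \<nu>" and sets: "sets borel \<subseteq> sets \<nu>"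
    and a: "a > 0" and M: "M > 0"
    and shell: "\<And>R. R \<ge> M \<Longrightarrow> measure \<nu> (cball 0 (2 * R) - ball 0 R) \<le> K * R powr (- a)"
    and R: "R \<ge> M"
  shows "measure \<nu> (UNIV - ball 0 R) \<le> K / (1 - 2 powr (- a)) * R powr (- a)"
proof -
  interpret finite_measure \<nu> by fact
  let ?S = "\<lambda>k. cball (0::'a) (2 * (2 ^ k * R)) - ball 0 (2 ^ k * R)"
  let ?q = "2 powr (- a) :: real"
  have R0: "R > 0" using R M by simp
  have q: "0 < ?q" "?q < 1"
    using a by (auto simp: powr_less_one)
  have bound: "measure \<nu> (?S k) \<le> K * R powr (- a) * ?q ^ k" for k
  proof -
    have "M * 1 \<le> R * 2 ^ k"
      using R M by (intro mult_mono) auto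
    then have "measure \<nu> (?S k) \<le> K * (2 ^ k * R) powr (- a)"
      by (intro shell) (simp add: mult.commute)
    also have "(2 ^ k * R) powr (- a) = R powr (- a) * ?q ^ k"
      using R0 by (simp add: powr_mult powr_powr mult.commute flip: powr_realpow)
    finally show ?thesis by simp
  qed
  have geo: "(\<lambda>k. K * R powr (- a) * ?q ^ k) sums (K * R powr (- a) * (1 / (1 - ?q)))"
    using q by (intro sums_mult geometric_sums) auto
  have summable: "summable (\<lambda>k. measure \<nu> (?S k))"
    using bound by (intro summable_comparison_test'[OF sums_summable[OF geo], of 0]) simp
  have "range ?S \<subseteq> sets borel"
    by auto
  then have "measure \<nu> (\<Union>k. ?S k) \<le> (\<Sum>k. measure \<nu> (?S k))"
    using sets summable by (intro finite_measure_subadditive_countably) auto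
  also have "\<dots> \<le> K * R powr (- a) * (1 / (1 - ?q))"
    using suminf_le[OF bound summable sums_summable[OF geo]] sums_unique[OF geo] by simp
  finally show ?thesis
    unfolding outside_ball_eq_Union_dyadic_shells[OF R0] by simp
qed

text \<open>The number of covering balls does not depend on \<open>R\<close>, and their centres have norm at
  least \<open>R\<close>, so each contributes at most \<open>C * R powr -a\<close>.\<close>

lemma shell_bound_if_ball_bound:
  fixes \<nu> :: "'a::euclidean_space measure"
  assumes fin: "finite_measure \<nu>" and sets: "sets borel \<subseteq> sets \<nu>"
    and a: "a > 0" and M: "M > 0" and C: "C \<ge> 0"
    and ball: "\<And>x. norm x \<ge> M \<Longrightarrow> measure \<nu> (ball x (norm x / 2)) \<le> C * norm x powr (- a)"
  obtains K where "\<And>R. R \<ge> M \<Longrightarrow> measure \<nu> (cball 0 (2 * R) - ball 0 R) \<le> K * R powr (- a)"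
proof -
  interpret finite_measure \<nu> by fact
  obtain X :: "'a set" where X: "finite X" "\<And>x. x \<in> X \<Longrightarrow> norm x \<ge> 1"
    and cover: "\<And>R. R > 0 \<Longrightarrow>
      cball 0 (2 * R) - ball 0 R \<subseteq> (\<Union>x\<in>X. ball (R *\<^sub>R x) (norm (R *\<^sub>R x) / 2))"
    by (rule finite_dilated_ball_cover_shell) blast
  have balls: "ball x r \<in> sets \<nu>" for x r
    using sets by auto
  show thesis
  proof
    fix R assume R: "R \<ge> M"
    then have R0: "R > 0" using M by simp
    have "measure \<nu> (cball 0 (2 * R) - ball 0 R)
        \<le> measure \<nu> (\<Union>x\<in>X. ball (R *\<^sub>R x) (norm (R *\<^sub>R x) / 2))"
      using X(1) balls by (intro finite_measure_mono cover R0) auto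
    also have "\<dots> \<le> (\<Sum>x\<in>X. measure \<nu> (ball (R *\<^sub>R x) (norm (R *\<^sub>R x) / 2)))"
      using X(1) balls by (intro finite_measure_subadditive_finite) auto
    also have "\<dots> \<le> (\<Sum>x\<in>X. C * R powr (- a))"
    proof (rule sum_mono)
      fix x assume x: "x \<in> X"
      have le: "R * 1 \<le> norm (R *\<^sub>R x)"
        using X(2)[OF x] R0 by (simp del: mult_1_right)
      then have "measure \<nu> (ball (R *\<^sub>R x) (norm (R *\<^sub>R x) / 2)) \<le> C * norm (R *\<^sub>R x) powr (- a)"
        using R by (intro ball) simp
      also have "\<dots> \<le> C * R powr (- a)"
        using le R0 a C by (intro mult_left_mono powr_mono2') auto
      finally show "measure \<nu> (ball (R *\<^sub>R x) (norm (R *\<^sub>R x) / 2)) \<le> C * R powr (- a)" .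
    qed
    finally show "measure \<nu> (cball 0 (2 * R) - ball 0 R) \<le> (card X * C) * R powr (- a)"
      by simp
  qed
qed

lemma tail_decay_iff_ball_decay:
  fixes \<nu> :: "'a::euclidean_space measure"
  assumes fin: "finite_measure \<nu>" and sets: "sets borel \<subseteq> sets \<nu>" and a: "a > 0"
  shows "(SUP R\<in>{0<..}. ennreal (R powr a) * emeasure \<nu> (UNIV - ball 0 R)) < \<infinity>
    \<longleftrightarrow> (\<lambda>x. measure \<nu> (ball x (norm x / 2))) \<in> O[at_infinity](\<lambda>x. norm x powr (- a))"
    (is "?sup < \<infinity> \<longleftrightarrow> ?bigo")
proof
  interpret finite_measure \<nu> by fact
  have tails: "UNIV - ball 0 R \<in> sets \<nu>" for R
    using sets by auto
  have term_eq: "ennreal (R powr a) * emeasure \<nu> (UNIV - ball 0 R)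
      = ennreal (R powr a * measure \<nu> (UNIV - ball 0 R))" for R
    by (simp add: emeasure_eq_measure ennreal_mult)
  {
    assume "?sup < \<infinity>"
    then obtain C where C: "C \<ge> 0" "?sup = ennreal C"
      by (cases ?sup) auto
    have tail: "R powr a * measure \<nu> (UNIV - ball 0 R) \<le> C" if "R > 0" for R
    proof -
      have "ennreal (R powr a * measure \<nu> (UNIV - ball 0 R)) \<le> ?sup"
        unfolding term_eq[symmetric] using that by (intro SUP_upper) auto
      then show ?thesis using C by simp
    qed
    have "measure \<nu> (ball x (norm x / 2)) \<le> C * 2 powr a * norm x powr (- a)"
      if x: "norm x \<ge> 1" for x :: 'a
    proof -
      have pos: "norm x / 2 > 0" using x by linarith
      have "ball x (norm x / 2) \<subseteq> UNIV - ball 0 (norm x / 2)"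
      proof
        fix y assume "y \<in> ball x (norm x / 2)"
        then have "norm (x - y) < norm x / 2" by (simp add: dist_norm)
        then show "y \<in> UNIV - ball 0 (norm x / 2)"
          using norm_triangle_sub[of x y] by simp
      qed
      then have "measure \<nu> (ball x (norm x / 2)) \<le> measure \<nu> (UNIV - ball 0 (norm x / 2))"
        by (intro finite_measure_mono tails)
      also have "\<dots> \<le> C / (norm x / 2) powr a"
        using tail[OF pos] pos by (subst pos_le_divide_eq) (auto simp: mult.commute)
      also have "\<dots> = C * 2 powr a * norm x powr (- a)"
        using x by (simp add: powr_divide powr_minus field_simps)
      finally show ?thesis .
    qed
    then show ?bigo
      by (intro bigoI[of _ "C * 2 powr a"]) (auto simp: eventually_at_infinity)
  }
  {
    assume ?bigo
    then obtain C where C: "C > 0" and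
      ev: "eventually (\<lambda>x::'a. norm (measure \<nu> (ball x (norm x / 2))) \<le> C * norm (norm x powr (- a)))
        at_infinity"
      by (elim landau_o.bigE)
    then obtain b where b: "\<And>x::'a. norm x \<ge> b \<Longrightarrow>
        measure \<nu> (ball x (norm x / 2)) \<le> C * norm x powr (- a)"
      by (auto simp: eventually_at_infinity)
    define M where "M = max b 1"
    have M: "M > 0" and ball: "\<And>x::'a. norm x \<ge> M \<Longrightarrow>
        measure \<nu> (ball x (norm x / 2)) \<le> C * norm x powr (- a)"
      using b by (auto simp: M_def)
    obtain K where shell: "\<And>R. R \<ge> M \<Longrightarrow>
        measure \<nu> (cball 0 (2 * R) - ball 0 R) \<le> K * R powr (- a)"
      using shell_bound_if_ball_bound[OF fin sets a M less_imp_le[OF C] ball] by blast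
    let ?L = "K / (1 - 2 powr (- a))"
    let ?B = "max ?L (M powr a * measure \<nu> UNIV)"
    have "R powr a * measure \<nu> (UNIV - ball 0 R) \<le> ?B" if R: "R > 0" for R
    proof (cases "R \<ge> M")
      case True
      have "R powr a * measure \<nu> (UNIV - ball 0 R) \<le> R powr a * (?L * R powr (- a))"
        by (intro mult_left_mono tail_bound_if_shell_bound[OF fin sets a M shell True]) auto
      also have "\<dots> = ?L"
        using R by (simp add: powr_minus)
      finally show ?thesis by simp
    next
      case False
      have "UNIV \<in> sets \<nu>" using sets by auto
      then have "R powr a * measure \<nu> (UNIV - ball 0 R) \<le> M powr a * measure \<nu> UNIV"
        using False R a by (intro mult_mono powr_mono2 finite_measure_mono) auto
      then show ?thesis by simp
    qed
    then have "?sup \<le> ennreal ?B"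
      by (intro SUP_least) (auto simp: term_eq intro!: ennreal_leI simp del: max.bounded_iff)
    then show "?sup < \<infinity>"
      using ennreal_less_top[of ?B] by (simp add: order.strict_trans1)
  }
qed

section \<open>The weighted integrals\<close>

text \<open>This is where \<open>m > m\<^sub>c\<close> is used: it says that \<open>1 - m < (2 + \<beta> - \<gamma>) / (d - \<gamma>)\<close>.\<close>

lemma decay_exponent_pos:
  assumes "\<gamma> < real d" and "m_c d \<gamma> \<beta> < m" and "m < 1"
  shows "(2 + \<beta> - \<gamma>) / (1 - m) - (real d - \<gamma>) > 0"
proof -
  have "real d - 2 - \<beta> < m * (real d - \<gamma>)"
    using assms by (simp add: m_c_def pos_divide_less_eq)
  then have "(real d - \<gamma>) * (1 - m) < 2 + \<beta> - \<gamma>"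
    by (simp add: algebra_simps)
  then show ?thesis
    using assms by (simp add: pos_less_divide_eq)
qed

theorem proposition5p1:
  fixes f :: "real ^ 'n \<Rightarrow> real"
    and d :: nat
    and \<gamma> \<beta> m :: real
  assumes "d = CARD('n)" and "d \<ge> 3"
    and "\<gamma> < real d" and "\<beta> < real d"
    and "\<gamma> - 2 < \<beta>" and "\<beta> \<le> \<gamma> * (real d - 2) / real d"
    and "m_c d \<gamma> \<beta> < m" and "m < 1"
    and "f \<in> borel_measurable lebesgue"
    and "(\<integral>\<^sup>+ x. ennreal (\<bar>f x\<bar> * norm x powr (- \<gamma>)) \<partial>lebesgue) < \<infinity>"
  shows "(SUP R\<in>{0<..}. ennreal (R powr ((2 + \<beta> - \<gamma>) / (1 - m) - (real d - \<gamma>))) *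
            (\<integral>\<^sup>+ x \<in> UNIV - ball 0 R. ennreal (\<bar>f x\<bar> * norm x powr (- \<gamma>)) \<partial>lebesgue)) < \<infinity>
     \<longleftrightarrow> (\<lambda>x :: real ^ 'n. LINT y : ball x (norm x / 2) | lebesgue. \<bar>f y\<bar> * norm y powr (- \<gamma>))
          \<in> O[at_infinity](\<lambda>x. norm x powr (real d - \<gamma> - (2 + \<beta> - \<gamma>) / (1 - m)))"
proof -
  define g where "g x = \<bar>f x\<bar> * norm x powr (- \<gamma>)" for x
  define \<nu> where "\<nu> = density lebesgue (\<lambda>x. ennreal (g x))"
  let ?a = "(2 + \<beta> - \<gamma>) / (1 - m) - (real d - \<gamma>)"
  have a: "?a > 0"
    using assms by (intro decay_exponent_pos)
  have "(\<lambda>x::real^'n. norm x powr (- \<gamma>)) \<in> borel_measurable lborel"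
    by simp
  then have "(\<lambda>x::real^'n. norm x powr (- \<gamma>)) \<in> borel_measurable lebesgue"
    by (rule measurable_completion)
  then have g[measurable]: "g \<in> borel_measurable lebesgue"
    unfolding g_def[abs_def] using assms(9) by measurable
  have g_nonneg: "g x \<ge> 0" for x
    by (simp add: g_def)
  have sets: "sets borel \<subseteq> sets \<nu>"
    by (auto simp: \<nu>_def)
  have em: "emeasure \<nu> A = (\<integral>\<^sup>+ x \<in> A. ennreal (g x) \<partial>lebesgue)" if "A \<in> sets borel" for A
    unfolding \<nu>_def using that by (intro emeasure_density) auto
  have "finite_measure \<nu>"
    using assms(10) em[of UNIV] by (intro finite_measureI) (auto simp: \<nu>_def g_def)
  have me: "(LINT y : A | lebesgue. g y) = measure \<nu> A" if A: "A \<in> sets borel" for A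
  proof -
    have AL: "A \<in> sets lebesgue" using A by simp
    have "(LINT y : A | lebesgue. g y) = enn2real (\<integral>\<^sup>+ y. ennreal (indicator A y *\<^sub>R g y) \<partial>lebesgue)"
      unfolding set_lebesgue_integral_def using g_nonneg AL
      by (intro integral_eq_nn_integral) auto
    also have "(\<integral>\<^sup>+ y. ennreal (indicator A y *\<^sub>R g y) \<partial>lebesgue) = emeasure \<nu> A"
      unfolding em[OF A] by (intro nn_integral_cong) (auto simp: indicator_def)
    finally show ?thesis by (simp add: measure_def)
  qed
  have "- ?a = real d - \<gamma> - (2 + \<beta> - \<gamma>) / (1 - m)"
    by simp
  then show ?thesis
    using tail_decay_iff_ball_decay[OF \<open>finite_measure \<nu>\<close> sets a]
    by (simp add: em me flip: g_def)
qed

end
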